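(* Let $F_5$ be the free group on $x_1,x_2,x_3,x_4,q$ and let $\psi:\mathcal{VB}_4\to\mathrm{Aut}(F_5)$ be the homomorphism with $\psi(\sigma_i)(q)=\psi(\tau_i)(q)=q$ and \[\psi(\sigma_i)(x_j)=\begin{cases}x_j & j\ne i,i+1\\ x_ix_{i+1}x_i^{-1}& j=i\\ x_i & j=i+1\end{cases},\qquad \psi(\tau_i)(x_j)=\begin{cases}x_j & j\ne i,i+1\\ qx_{i+1}q^{-1}& j=i\\ q^{-1}x_iq & j=i+1\end{cases}\] for $1\le i\le 3$. Then the virtual braid $\beta=(\tau_3\sigma_2\tau_1\sigma_2^{-1})^3\in\mathcal{VB}_4$ lies in $\ker\psi$.
   Context: The virtual braid group $\mathcal{VB}_n$ has generators $\sigma_1,\dots,\sigma_{n-1},\tau_1,\dots,\tau_{n-1}$ and relations: $\sigma_i\sigma_j=\sigma_j\sigma_i$, $\tau_i\tau_j=\tau_j\tau_i$, $\sigma_i\tau_j=\tau_j\sigma_i$ for $|i-j|>1$; $\sigma_i\sigma_{i+1}\sigma_i=\sigma_{i+1}\sigma_i\sigma_{i+1}$, $\tau_i\tau_{i+1}\tau_i=\tau_{i+1}\tau_i\tau_{i+1}$, $\tau_{i+1}\sigma_i\tau_{i+1}=\tau_i\sigma_{i+1}\tau_i$ for $1\le i\le n-2$; $\tau_i^2=1$ for $1\le i\le n-1$. The product in $\mathrm{Aut}(F_{n+1})$ is composition of functions, $\psi(\alpha\beta)=\psi(\alpha)\circ\psi(\beta)$. *)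

theory Defs
  imports "HOL-Algebra.Coset" "HOL-Algebra.Bij"
begin

section \<open>Groups given by generators and relations\<close>

text \<open>
  A word over an alphabet is a list of letters with signs: \<open>(a, True)\<close> stands for the letter
  \<open>a\<close> and \<open>(a, False)\<close> for its formal inverse. A relation is a pair \<open>(l, r)\<close> of words, read as
  the equation \<open>l = r\<close>.
\<close>

type_synonym 'a word = "('a \<times> bool) list"

definition words :: "'a set \<Rightarrow> 'a word set"
  where "words S = lists (S \<times> UNIV)"

inductive word_cong :: "'a set \<Rightarrow> ('a word \<times> 'a word) set \<Rightarrow> 'a word \<Rightarrow> 'a word \<Rightarrow> bool"
  for S R where
  refl: "w \<in> words S \<Longrightarrow> word_cong S R w w"
| sym: "word_cong S R v w \<Longrightarrow> word_cong S R w v"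
| trans: "word_cong S R u v \<Longrightarrow> word_cong S R v w \<Longrightarrow> word_cong S R u w"
| cancel: "u \<in> words S \<Longrightarrow> v \<in> words S \<Longrightarrow> a \<in> S
    \<Longrightarrow> word_cong S R (u @ [(a, b), (a, \<not> b)] @ v) (u @ v)"
| relation: "u \<in> words S \<Longrightarrow> v \<in> words S \<Longrightarrow> (l, r) \<in> R \<Longrightarrow> l \<in> words S \<Longrightarrow> r \<in> words S
    \<Longrightarrow> word_cong S R (u @ l @ v) (u @ r @ v)"

definition word_class :: "'a set \<Rightarrow> ('a word \<times> 'a word) set \<Rightarrow> 'a word \<Rightarrow> 'a word set"
  where "word_class S R w = {v. word_cong S R w v}"

definition presented_group :: "'a set \<Rightarrow> ('a word \<times> 'a word) set \<Rightarrow> 'a word set monoid"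
  where "presented_group S R =
    \<lparr>carrier = word_class S R ` words S,
     mult = \<lambda>A B. {w. \<exists>u\<in>A. \<exists>v\<in>B. word_cong S R (u @ v) w},
     one = word_class S R []\<rparr>"

definition generator :: "'a set \<Rightarrow> ('a word \<times> 'a word) set \<Rightarrow> 'a \<Rightarrow> 'a word set"
  where "generator S R a = word_class S R [(a, True)]"

abbreviation free_group :: "'a set \<Rightarrow> 'a word set monoid"
  where "free_group S \<equiv> presented_group S {}"

definition positive_word :: "'a list \<Rightarrow> 'a word"
  where "positive_word = map (\<lambda>a. (a, True))"

section \<open>The virtual braid group\<close>

datatype vb_letter = Sig nat | Tau nat

definition vb_letters :: "nat \<Rightarrow> vb_letter set"
  where "vb_letters n = Sig ` {1..<n} \<union> Tau ` {1..<n}"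

text \<open>Every relation of the virtual braid group equates two words without inverses.\<close>

inductive_set vb_relations :: "nat \<Rightarrow> (vb_letter list \<times> vb_letter list) set"
  for n :: nat where
  sig_comm: "i \<in> {1..<n} \<Longrightarrow> j \<in> {1..<n} \<Longrightarrow> \<bar>int i - int j\<bar> > 1
    \<Longrightarrow> ([Sig i, Sig j], [Sig j, Sig i]) \<in> vb_relations n"
| tau_comm: "i \<in> {1..<n} \<Longrightarrow> j \<in> {1..<n} \<Longrightarrow> \<bar>int i - int j\<bar> > 1
    \<Longrightarrow> ([Tau i, Tau j], [Tau j, Tau i]) \<in> vb_relations n"
| sig_tau_comm: "i \<in> {1..<n} \<Longrightarrow> j \<in> {1..<n} \<Longrightarrow> \<bar>int i - int j\<bar> > 1
    \<Longrightarrow> ([Sig i, Tau j], [Tau j, Sig i]) \<in> vb_relations n"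
| sig_braid: "i \<ge> 1 \<Longrightarrow> i + 2 \<le> n
    \<Longrightarrow> ([Sig i, Sig (i+1), Sig i], [Sig (i+1), Sig i, Sig (i+1)]) \<in> vb_relations n"
| tau_braid: "i \<ge> 1 \<Longrightarrow> i + 2 \<le> n
    \<Longrightarrow> ([Tau i, Tau (i+1), Tau i], [Tau (i+1), Tau i, Tau (i+1)]) \<in> vb_relations n"
| mixed: "i \<ge> 1 \<Longrightarrow> i + 2 \<le> n
    \<Longrightarrow> ([Tau (i+1), Sig i, Tau (i+1)], [Tau i, Sig (i+1), Tau i]) \<in> vb_relations n"
| tau_square: "i \<in> {1..<n} \<Longrightarrow> ([Tau i, Tau i], []) \<in> vb_relations n"

abbreviation vb_rels :: "nat \<Rightarrow> (vb_letter word \<times> vb_letter word) set"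
  where "vb_rels n \<equiv> map_prod positive_word positive_word ` vb_relations n"

definition VB :: "nat \<Rightarrow> vb_letter word set monoid"
  where "VB n = presented_group (vb_letters n) (vb_rels n)"

definition vb_sigma :: "nat \<Rightarrow> nat \<Rightarrow> vb_letter word set"
  where "vb_sigma n i = generator (vb_letters n) (vb_rels n) (Sig i)"

definition vb_tau :: "nat \<Rightarrow> nat \<Rightarrow> vb_letter word set"
  where "vb_tau n i = generator (vb_letters n) (vb_rels n) (Tau i)"

section \<open>The free group on \<open>x\<^sub>1, \<dots>, x\<^sub>n, q\<close>\<close>

datatype xq_letter = X nat | Q

definition xq_letters :: "nat \<Rightarrow> xq_letter set"
  where "xq_letters n = insert Q (X ` {1..n})"

definition Fxq :: "nat \<Rightarrow> xq_letter word set monoid"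
  where "Fxq n = free_group (xq_letters n)"

definition xgen :: "nat \<Rightarrow> nat \<Rightarrow> xq_letter word set"
  where "xgen n j = generator (xq_letters n) {} (X j)"

definition qgen :: "nat \<Rightarrow> xq_letter word set"
  where "qgen n = generator (xq_letters n) {} Q"

section \<open>Basic facts on presented groups\<close>

lemma words_simps [simp]:
  "[] \<in> words S" "(x # w) \<in> words S \<longleftrightarrow> fst x \<in> S \<and> w \<in> words S"
  "(u @ v) \<in> words S \<longleftrightarrow> u \<in> words S \<and> v \<in> words S"
  by (auto simp: words_def mem_Times_iff)

lemma word_cong_words: "word_cong S R v w \<Longrightarrow> v \<in> words S \<and> w \<in> words S"
  by (induction rule: word_cong.induct) auto

lemma word_cong_append_left:
  assumes "word_cong S R v w" "u \<in> words S"
  shows "word_cong S R (u @ v) (u @ w)"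
  using assms(1)
proof (induction rule: word_cong.induct)
  case (refl w) then show ?case using assms(2) by (auto intro: word_cong.refl)
next
  case (sym v w) then show ?case by (blast intro: word_cong.sym)
next
  case (trans u v w) then show ?case by (blast intro: word_cong.trans)
next
  case (cancel u' v a b)
  then show ?case using word_cong.cancel[of "u @ u'" S v a R b] assms(2) by simp
next
  case (relation u' v l r)
  then show ?case using word_cong.relation[of "u @ u'" S v l r R] assms(2) by simp
qed

lemma word_cong_append_right:
  assumes "word_cong S R v w" "u \<in> words S"
  shows "word_cong S R (v @ u) (w @ u)"
  using assms(1)
proof (induction rule: word_cong.induct)
  case (refl w) then show ?case using assms(2) by (auto intro: word_cong.refl)
next
  case (sym v w) then show ?case by (blast intro: word_cong.sym)
next
  case (trans u v w) then show ?case by (blast intro: word_cong.trans)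
next
  case (cancel u' v a b)
  then show ?case using word_cong.cancel[of u' S "v @ u" a R b] assms(2) by simp
next
  case (relation u' v l r)
  then show ?case using word_cong.relation[of u' S "v @ u" l r R] assms(2) by simp
qed

lemma word_cong_append:
  assumes "word_cong S R u u'" "word_cong S R v v'"
  shows "word_cong S R (u @ v) (u' @ v')"
  using assms word_cong_append_left word_cong_append_right word_cong_words
  by (metis word_cong.trans)

lemma word_class_eq_iff:
  "v \<in> words S \<Longrightarrow> w \<in> words S \<Longrightarrow> word_class S R v = word_class S R w \<longleftrightarrow> word_cong S R v w"
  unfolding word_class_def by (auto intro: word_cong.intros)

lemma carrier_presented_group:
  "carrier (presented_group S R) = word_class S R ` words S"
  by (simp add: presented_group_def)

lemma one_presented_group: "\<one>\<^bsub>presented_group S R\<^esub> = word_class S R []"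
  by (simp add: presented_group_def)

lemma mult_presented_group:
  assumes "u \<in> words S" "v \<in> words S"
  shows "word_class S R u \<otimes>\<^bsub>presented_group S R\<^esub> word_class S R v = word_class S R (u @ v)"
proof (rule Set.set_eqI)
  fix w
  have "word_cong S R (u @ v) w"
    if "word_cong S R u u'" "word_cong S R v v'" "word_cong S R (u' @ v') w" for u' v'
    using that word_cong_append word_cong.trans by metis
  then show "w \<in> word_class S R u \<otimes>\<^bsub>presented_group S R\<^esub> word_class S R v
      \<longleftrightarrow> w \<in> word_class S R (u @ v)"
    using word_cong.refl[OF assms(1), of R] word_cong.refl[OF assms(2), of R]
    unfolding presented_group_def word_class_def monoid.simps partial_object.simps mem_Collect_eq
    by blast
qed

definition inverse_word :: "'a word \<Rightarrow> 'a word"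
  where "inverse_word w = rev (map (\<lambda>(a, b). (a, \<not> b)) w)"

lemma inverse_word_words [simp]: "w \<in> words S \<Longrightarrow> inverse_word w \<in> words S"
  by (induction w) (auto simp: inverse_word_def)

lemma word_cong_inverse:
  "w \<in> words S \<Longrightarrow> word_cong S R (inverse_word w @ w) []"
proof (induction w)
  case Nil then show ?case by (simp add: inverse_word_def word_cong.refl)
next
  case (Cons x w)
  obtain a b where x: "x = (a, b)" by (cases x)
  have "word_cong S R (inverse_word w @ [(a, \<not> b), (a, \<not> \<not> b)] @ w) (inverse_word w @ w)"
    using Cons.prems x by (intro word_cong.cancel) auto
  moreover have "word_cong S R (inverse_word w @ w) []" using Cons by simp
  ultimately show ?case
    using x by (auto simp: inverse_word_def intro: word_cong.trans)
qed

lemma group_presented_group: "group (presented_group S R)"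
proof (rule groupI)
  fix A assume "A \<in> carrier (presented_group S R)"
  then obtain w where w: "w \<in> words S" "A = word_class S R w"
    by (auto simp: carrier_presented_group)
  have "word_class S R (inverse_word w) \<otimes>\<^bsub>presented_group S R\<^esub> A = \<one>\<^bsub>presented_group S R\<^esub>"
    using w by (simp add: mult_presented_group one_presented_group word_class_eq_iff word_cong_inverse)
  then show "\<exists>B\<in>carrier (presented_group S R). B \<otimes>\<^bsub>presented_group S R\<^esub> A = \<one>\<^bsub>presented_group S R\<^esub>"
    using w by (auto simp: carrier_presented_group)
qed (auto simp: carrier_presented_group one_presented_group mult_presented_group)

lemma generator_closed: "a \<in> S \<Longrightarrow> generator S R a \<in> carrier (presented_group S R)"
  by (simp add: carrier_presented_group generator_def)

lemma inv_generator:
  assumes "a \<in> S"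
  shows "inv\<^bsub>presented_group S R\<^esub> generator S R a = word_class S R [(a, False)]"
proof (rule group.inv_equality[OF group_presented_group])
  show "word_class S R [(a, False)] \<otimes>\<^bsub>presented_group S R\<^esub> generator S R a = \<one>\<^bsub>presented_group S R\<^esub>"
    using assms word_cong_inverse[of "[(a, True)]" S R]
    by (simp add: generator_def mult_presented_group one_presented_group word_class_eq_iff inverse_word_def)
qed (use assms in \<open>auto simp: carrier_presented_group generator_def\<close>)

lemma presented_group_hom_eq:
  assumes H: "group H"
    and f: "f \<in> hom (presented_group S R) H" and g: "g \<in> hom (presented_group S R) H"
    and eq: "\<And>a. a \<in> S \<Longrightarrow> f (generator S R a) = g (generator S R a)"
    and A: "A \<in> carrier (presented_group S R)"
  shows "f A = g A"
proof -
  interpret f: group_hom "presented_group S R" H f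
    using H f group_presented_group by (simp add: group_hom_def group_hom_axioms_def)
  interpret g: group_hom "presented_group S R" H g
    using H g group_presented_group by (simp add: group_hom_def group_hom_axioms_def)
  have letter: "f (word_class S R [(a, b)]) = g (word_class S R [(a, b)])" if a: "a \<in> S" for a b
  proof (cases b)
    case True then show ?thesis using eq[OF a] by (simp add: generator_def)
  next
    case False
    have "f (inv\<^bsub>presented_group S R\<^esub> generator S R a) = g (inv\<^bsub>presented_group S R\<^esub> generator S R a)"
      using eq[OF a] generator_closed[OF a] by simp
    then show ?thesis using a False by (simp add: inv_generator)
  qed
  have "f (word_class S R w) = g (word_class S R w)" if "w \<in> words S" for w
    using that
  proof (induction w)
    case Nil then show ?case using f.hom_one g.hom_one by (simp add: one_presented_group)
  next
    case (Cons x w)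
    obtain a b where x: "x = (a, b)" by (cases x)
    have "word_class S R (x # w) = word_class S R [(a, b)] \<otimes>\<^bsub>presented_group S R\<^esub> word_class S R w"
      using Cons.prems x by (simp add: mult_presented_group)
    moreover have "word_class S R [(a, b)] \<in> carrier (presented_group S R)"
      "word_class S R w \<in> carrier (presented_group S R)"
      using Cons.prems x by (auto simp: carrier_presented_group)
    ultimately show ?case using Cons letter x by simp
  qed
  then show ?thesis using A by (auto simp: carrier_presented_group)
qed

fun word_value :: "('b, 'c) monoid_scheme \<Rightarrow> ('a \<Rightarrow> 'b) \<Rightarrow> 'a word \<Rightarrow> 'b"
  where
  "word_value H f [] = \<one>\<^bsub>H\<^esub>"
| "word_value H f ((a, b) # w) = (if b then f a else inv\<^bsub>H\<^esub> f a) \<otimes>\<^bsub>H\<^esub> word_value H f w"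

lemma presented_group_hom_exists:
  assumes H: "group H" and f: "\<And>a. a \<in> S \<Longrightarrow> f a \<in> carrier H"
    and R: "\<And>l r. (l, r) \<in> R \<Longrightarrow> l \<in> words S \<Longrightarrow> r \<in> words S \<Longrightarrow> word_value H f l = word_value H f r"
  shows "\<exists>h \<in> hom (presented_group S R) H. \<forall>a\<in>S. h (generator S R a) = f a"
proof -
  interpret group H by (rule H)
  have closed: "word_value H f w \<in> carrier H" if "w \<in> words S" for w
    using that f by (induction w) (auto simp: words_def)
  have app: "word_value H f (u @ v) = word_value H f u \<otimes>\<^bsub>H\<^esub> word_value H f v"
    if "u \<in> words S" "v \<in> words S" for u v
    using that f by (induction u) (auto simp: closed m_assoc)
  have canc: "word_value H f ([(a, b), (a, \<not> b)] @ v) = word_value H f v"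
    if "a \<in> S" "v \<in> words S" for a b v
    using that f by (auto simp: closed m_assoc[symmetric])
  have cong: "word_value H f v = word_value H f w" if "word_cong S R v w" for v w
    using that
  proof (induction rule: word_cong.induct)
    case (cancel u v a b)
    then have "[(a, b), (a, \<not> b)] @ v \<in> words S" by simp
    then show ?case using cancel by (simp only: app canc)
  next
    case (relation u v l r)
    then show ?case using R by (simp add: app)
  qed auto
  define h where "h A = word_value H f (SOME w. w \<in> A)" for A
  have h: "h (word_class S R w) = word_value H f w" if "w \<in> words S" for w
  proof -
    have "w \<in> word_class S R w" using that by (simp add: word_class_def word_cong.refl)
    then have "(SOME v. v \<in> word_class S R w) \<in> word_class S R w" by (rule someI)
    then show ?thesis unfolding h_def using cong by (simp add: word_class_def)
  qed
  have "h \<in> hom (presented_group S R) H"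
    by (rule homI) (auto simp: carrier_presented_group mult_presented_group h closed app)
  moreover have "h (generator S R a) = f a" if "a \<in> S" for a
    using that f by (simp add: generator_def h)
  ultimately show ?thesis by blast
qed

section \<open>Existence of the representation by automorphisms of the free group\<close>

lemma group_Fxq: "group (Fxq n)"
  by (simp add: Fxq_def group_presented_group)

lemma xgen_closed: "j \<in> {1..n} \<Longrightarrow> xgen n j \<in> carrier (Fxq n)"
  by (simp add: xgen_def Fxq_def generator_closed xq_letters_def)

lemma qgen_closed: "qgen n \<in> carrier (Fxq n)"
  by (simp add: qgen_def Fxq_def generator_closed xq_letters_def)

lemma Fxq_hom_eq:
  assumes "f \<in> hom (Fxq n) (Fxq n)" "g \<in> hom (Fxq n) (Fxq n)"
    and "f (qgen n) = g (qgen n)" "\<And>j. j \<in> {1..n} \<Longrightarrow> f (xgen n j) = g (xgen n j)"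
    and "A \<in> carrier (Fxq n)"
  shows "f A = g A"
proof (rule presented_group_hom_eq[of "Fxq n" f "xq_letters n" "{}" g A])
  show "f (generator (xq_letters n) {} a) = g (generator (xq_letters n) {} a)"
    if "a \<in> xq_letters n" for a
    using that assms(3,4) by (auto simp: xq_letters_def qgen_def xgen_def)
qed (use assms group_Fxq in \<open>auto simp: Fxq_def\<close>)

lemma Fxq_hom_exists:
  assumes "\<And>j. j \<in> {1..n} \<Longrightarrow> c j \<in> carrier (Fxq n)"
  obtains h where "h \<in> hom (Fxq n) (Fxq n)" "h (qgen n) = qgen n"
    "\<And>j. j \<in> {1..n} \<Longrightarrow> h (xgen n j) = c j"
proof -
  have "\<exists>h \<in> hom (presented_group (xq_letters n) {}) (Fxq n).
      \<forall>a\<in>xq_letters n. h (generator (xq_letters n) {} a) = (case a of X j \<Rightarrow> c j | Q \<Rightarrow> qgen n)"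
    by (rule presented_group_hom_exists)
      (use assms group_Fxq qgen_closed in \<open>auto simp: xq_letters_def\<close>)
  then obtain h where "h \<in> hom (presented_group (xq_letters n) {}) (Fxq n)"
    "\<forall>a\<in>xq_letters n. h (generator (xq_letters n) {} a) = (case a of X j \<Rightarrow> c j | Q \<Rightarrow> qgen n)"
    by blast
  then show thesis by (intro that[of h]) (auto simp: Fxq_def qgen_def xgen_def xq_letters_def)
qed

lemma Fxq_auto_exists:
  assumes c: "\<And>j. j \<in> {1..n} \<Longrightarrow> c j \<in> carrier (Fxq n)"
    and d: "\<And>j. j \<in> {1..n} \<Longrightarrow> d j \<in> carrier (Fxq n)"
    and cd: "\<And>h j. h \<in> hom (Fxq n) (Fxq n) \<Longrightarrow> h (qgen n) = qgen n \<Longrightarrow>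
      (\<And>k. k \<in> {1..n} \<Longrightarrow> h (xgen n k) = c k) \<Longrightarrow> j \<in> {1..n} \<Longrightarrow> h (d j) = xgen n j"
    and dc: "\<And>h j. h \<in> hom (Fxq n) (Fxq n) \<Longrightarrow> h (qgen n) = qgen n \<Longrightarrow>
      (\<And>k. k \<in> {1..n} \<Longrightarrow> h (xgen n k) = d k) \<Longrightarrow> j \<in> {1..n} \<Longrightarrow> h (c j) = xgen n j"
  shows "\<exists>f \<in> auto (Fxq n). f (qgen n) = qgen n \<and> (\<forall>j\<in>{1..n}. f (xgen n j) = c j)"
proof -
  obtain g where g: "g \<in> hom (Fxq n) (Fxq n)" "g (qgen n) = qgen n"
    "\<And>j. j \<in> {1..n} \<Longrightarrow> g (xgen n j) = c j"
    using Fxq_hom_exists[of n c] c by metis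
  obtain h where h: "h \<in> hom (Fxq n) (Fxq n)" "h (qgen n) = qgen n"
    "\<And>j. j \<in> {1..n} \<Longrightarrow> h (xgen n j) = d j"
    using Fxq_hom_exists[of n d] d by metis
  have id: "(\<lambda>A. A) \<in> hom (Fxq n) (Fxq n)" by (auto simp: hom_def)
  have gh: "g (h A) = A" if "A \<in> carrier (Fxq n)" for A
    using Fxq_hom_eq[of "g \<circ> h" n "\<lambda>A. A" A] id g h that cd[OF g] Group.hom_compose[of h "Fxq n" "Fxq n" g "Fxq n"]
    by simp
  have hg: "h (g A) = A" if "A \<in> carrier (Fxq n)" for A
    using Fxq_hom_eq[of "h \<circ> g" n "\<lambda>A. A" A] id g h that dc[OF h] Group.hom_compose[of g "Fxq n" "Fxq n" h "Fxq n"]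
    by simp
  have "bij_betw g (carrier (Fxq n)) (carrier (Fxq n))"
    using g(1) h(1) gh hg by (intro bij_betw_byWitness[where f' = h]) (auto simp: hom_def)
  moreover have "restrict g (carrier (Fxq n)) \<in> hom (Fxq n) (Fxq n)"
    using g(1) group_Fxq by (auto simp: hom_def group.is_monoid monoid.m_closed)
  ultimately have "restrict g (carrier (Fxq n)) \<in> auto (Fxq n)"
    by (auto simp: auto_def Bij_def bij_betw_restrict_eq)
  then show ?thesis using g qgen_closed xgen_closed by (intro bexI) auto
qed

lemma AutoGroup_Fxq:
  "group (AutoGroup (Fxq n))" "carrier (AutoGroup (Fxq n)) = auto (Fxq n)"
  "\<one>\<^bsub>AutoGroup (Fxq n)\<^esub> = (\<lambda>A\<in>carrier (Fxq n). A)"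
  "f \<in> auto (Fxq n) \<Longrightarrow> g \<in> auto (Fxq n) \<Longrightarrow> A \<in> carrier (Fxq n) \<Longrightarrow>
    (f \<otimes>\<^bsub>AutoGroup (Fxq n)\<^esub> g) A = f (g A)"
  using group.AutoGroup[OF group_Fxq]
  by (auto simp: AutoGroup_def BijGroup_def auto_def compose_def)

lemma auto_Fxq_eqI:
  assumes "f \<in> auto (Fxq n)" "g \<in> auto (Fxq n)"
    and "f (qgen n) = g (qgen n)" "\<And>j. j \<in> {1..n} \<Longrightarrow> f (xgen n j) = g (xgen n j)"
  shows "f = g"
  by (rule extensionalityI[of _ "carrier (Fxq n)"])
    (use assms Fxq_hom_eq[of f n g] in \<open>auto simp: auto_def Bij_def\<close>)

text \<open>
  A homomorphism of groups as in the next lemma is unique on \<open>carrier (VB n)\<close>, since its values on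
  the generators are automorphisms prescribed on the free generators (see
  \<open>auto_Fxq_eqI\<close> and \<open>presented_group_hom_eq\<close>).
\<close>

lemma vb_representation_exists:
  "\<exists>psi \<in> hom (VB n) (AutoGroup (Fxq n)). \<forall>i\<in>{1..<n}.
     psi (vb_sigma n i) (qgen n) = qgen n \<and> psi (vb_tau n i) (qgen n) = qgen n \<and>
     (\<forall>j\<in>{1..n}. psi (vb_sigma n i) (xgen n j) =
        (if j = i then xgen n i \<otimes>\<^bsub>Fxq n\<^esub> xgen n (i+1) \<otimes>\<^bsub>Fxq n\<^esub> inv\<^bsub>Fxq n\<^esub> xgen n i
         else if j = i + 1 then xgen n i else xgen n j)) \<and>
     (\<forall>j\<in>{1..n}. psi (vb_tau n i) (xgen n j) =
        (if j = i then qgen n \<otimes>\<^bsub>Fxq n\<^esub> xgen n (i+1) \<otimes>\<^bsub>Fxq n\<^esub> inv\<^bsub>Fxq n\<^esub> qgen n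
         else if j = i + 1 then inv\<^bsub>Fxq n\<^esub> qgen n \<otimes>\<^bsub>Fxq n\<^esub> xgen n i \<otimes>\<^bsub>Fxq n\<^esub> qgen n
         else xgen n j))"
proof -
  let ?F = "Fxq n" and ?A = "AutoGroup (Fxq n)"
  interpret F: group ?F by (rule group_Fxq)
  interpret A: group ?A by (rule AutoGroup_Fxq(1))
  define x where "x = xgen n"
  define q where "q = qgen n"
  have xc [simp]: "x j \<in> carrier ?F" if "Suc 0 \<le> j" "j \<le> n" for j
    using that xgen_closed[of j n] by (simp add: x_def)
  have qc [simp]: "q \<in> carrier ?F" using qgen_closed by (simp add: q_def)
  have canc [simp]: "a \<otimes>\<^bsub>?F\<^esub> (inv\<^bsub>?F\<^esub> a \<otimes>\<^bsub>?F\<^esub> b) = b" "inv\<^bsub>?F\<^esub> a \<otimes>\<^bsub>?F\<^esub> (a \<otimes>\<^bsub>?F\<^esub> b) = b"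
    if "a \<in> carrier ?F" "b \<in> carrier ?F" for a b
    using that by (simp_all add: F.m_assoc[symmetric])
  have homs: "h (inv\<^bsub>?F\<^esub> a) = inv\<^bsub>?F\<^esub> h a" "h a \<in> carrier ?F"
    "b \<in> carrier ?F \<Longrightarrow> h (a \<otimes>\<^bsub>?F\<^esub> b) = h a \<otimes>\<^bsub>?F\<^esub> h b"
    if "h \<in> hom ?F ?F" "a \<in> carrier ?F" for h a b
  proof -
    interpret group_hom ?F ?F h using that(1) by (unfold_locales)
    show "h (inv\<^bsub>?F\<^esub> a) = inv\<^bsub>?F\<^esub> h a" "h a \<in> carrier ?F"
      "b \<in> carrier ?F \<Longrightarrow> h (a \<otimes>\<^bsub>?F\<^esub> b) = h a \<otimes>\<^bsub>?F\<^esub> h b"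
      using that by simp_all
  qed
  have sig_ex: "\<exists>f \<in> auto ?F. f q = q \<and> (\<forall>j\<in>{1..n}. f (x j) =
      (if j = i then x i \<otimes>\<^bsub>?F\<^esub> x (i+1) \<otimes>\<^bsub>?F\<^esub> inv\<^bsub>?F\<^esub> x i else if j = i + 1 then x i else x j))"
    if i: "i \<in> {1..<n}" for i
    unfolding x_def q_def
    by (rule Fxq_auto_exists[where
          d = "\<lambda>j. if j = i then x (i+1) else if j = i + 1 then inv\<^bsub>?F\<^esub> x (i+1) \<otimes>\<^bsub>?F\<^esub> x i \<otimes>\<^bsub>?F\<^esub> x (i+1) else x j"])
      (use i in \<open>auto simp: x_def[symmetric] q_def[symmetric] homs F.m_assoc F.inv_mult_group\<close>)
  have tau_ex: "\<exists>f \<in> auto ?F. f q = q \<and> (\<forall>j\<in>{1..n}. f (x j) =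
      (if j = i then q \<otimes>\<^bsub>?F\<^esub> x (i+1) \<otimes>\<^bsub>?F\<^esub> inv\<^bsub>?F\<^esub> q
       else if j = i + 1 then inv\<^bsub>?F\<^esub> q \<otimes>\<^bsub>?F\<^esub> x i \<otimes>\<^bsub>?F\<^esub> q else x j))"
    if i: "i \<in> {1..<n}" for i
    unfolding x_def q_def
    by (rule Fxq_auto_exists[where
          d = "\<lambda>j. if j = i then q \<otimes>\<^bsub>?F\<^esub> x (i+1) \<otimes>\<^bsub>?F\<^esub> inv\<^bsub>?F\<^esub> q
            else if j = i + 1 then inv\<^bsub>?F\<^esub> q \<otimes>\<^bsub>?F\<^esub> x i \<otimes>\<^bsub>?F\<^esub> q else x j"])
      (use i in \<open>auto simp: x_def[symmetric] q_def[symmetric] homs F.m_assoc F.inv_mult_group\<close>)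
  obtain s where s: "\<And>i. i \<in> {1..<n} \<Longrightarrow> s i \<in> auto ?F"
    "\<And>i. i \<in> {1..<n} \<Longrightarrow> s i q = q"
    "\<And>i j. i \<in> {1..<n} \<Longrightarrow> j \<in> {1..n} \<Longrightarrow> s i (x j) =
      (if j = i then x i \<otimes>\<^bsub>?F\<^esub> x (i+1) \<otimes>\<^bsub>?F\<^esub> inv\<^bsub>?F\<^esub> x i else if j = i + 1 then x i else x j)"
    using sig_ex by metis
  obtain t where t: "\<And>i. i \<in> {1..<n} \<Longrightarrow> t i \<in> auto ?F"
    "\<And>i. i \<in> {1..<n} \<Longrightarrow> t i q = q"
    "\<And>i j. i \<in> {1..<n} \<Longrightarrow> j \<in> {1..n} \<Longrightarrow> t i (x j) =
      (if j = i then q \<otimes>\<^bsub>?F\<^esub> x (i+1) \<otimes>\<^bsub>?F\<^esub> inv\<^bsub>?F\<^esub> q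
       else if j = i + 1 then inv\<^bsub>?F\<^esub> q \<otimes>\<^bsub>?F\<^esub> x i \<otimes>\<^bsub>?F\<^esub> q else x j)"
    using tau_ex by metis
  define f where "f a = (case a of Sig i \<Rightarrow> s i | Tau i \<Rightarrow> t i)" for a
  have fc: "f a \<in> auto ?F" if "a \<in> vb_letters n" for a
    using that s(1) t(1) by (auto simp: vb_letters_def f_def)
  have fh: "f a (inv\<^bsub>?F\<^esub> u) = inv\<^bsub>?F\<^esub> f a u" "f a u \<in> carrier ?F"
    "v \<in> carrier ?F \<Longrightarrow> f a (u \<otimes>\<^bsub>?F\<^esub> v) = f a u \<otimes>\<^bsub>?F\<^esub> f a v"
    if "a \<in> vb_letters n" "u \<in> carrier ?F" for a u v
    using that fc[of a] homs[of "f a" u] by (auto simp: auto_def)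
  have fv: "f (Sig i) q = q" "f (Tau i) q = q"
    "1 \<le> j \<Longrightarrow> j \<le> n \<Longrightarrow> f (Sig i) (x j) =
      (if j = i then x i \<otimes>\<^bsub>?F\<^esub> x (i+1) \<otimes>\<^bsub>?F\<^esub> inv\<^bsub>?F\<^esub> x i else if j = i + 1 then x i else x j)"
    "1 \<le> j \<Longrightarrow> j \<le> n \<Longrightarrow> f (Tau i) (x j) =
      (if j = i then q \<otimes>\<^bsub>?F\<^esub> x (i+1) \<otimes>\<^bsub>?F\<^esub> inv\<^bsub>?F\<^esub> q
       else if j = i + 1 then inv\<^bsub>?F\<^esub> q \<otimes>\<^bsub>?F\<^esub> x i \<otimes>\<^bsub>?F\<^esub> q else x j)"
    if "1 \<le> i" "i < n" for i j
    using that s t by (auto simp: f_def)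
  have val_closed: "word_value ?A f (positive_word w) \<in> auto ?F" if "set w \<subseteq> vb_letters n" for w
    using that
  proof (induction w)
    case Nil then show ?case using A.one_closed AutoGroup_Fxq(2) by (simp add: positive_word_def)
  next
    case (Cons a w)
    then show ?case using fc[of a] A.m_closed by (auto simp: positive_word_def AutoGroup_Fxq(2))
  qed
  have val: "word_value ?A f (positive_word w) u = foldr f w u"
    if "set w \<subseteq> vb_letters n" "u \<in> carrier ?F" for w u
    using that
  proof (induction w)
    case Nil then show ?case by (simp add: positive_word_def AutoGroup_Fxq(3))
  next
    case (Cons a w)
    then show ?case using fc[of a] val_closed[of w]
      by (simp add: positive_word_def AutoGroup_Fxq(4))
  qed
  have eqI: "word_value ?A f (positive_word l) = word_value ?A f (positive_word r)"
    if "set l \<subseteq> vb_letters n" "set r \<subseteq> vb_letters n" "foldr f l q = foldr f r q"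
      "\<And>j. j \<in> {1..n} \<Longrightarrow> foldr f l (x j) = foldr f r (x j)" for l r
    by (rule auto_Fxq_eqI[OF val_closed val_closed])
      (use that in \<open>auto simp: val x_def[symmetric] q_def[symmetric]\<close>)
  have letters [simp]: "Sig i \<in> vb_letters n \<longleftrightarrow> 1 \<le> i \<and> i < n" "Tau i \<in> vb_letters n \<longleftrightarrow> 1 \<le> i \<and> i < n" for i
    by (auto simp: vb_letters_def)
  have rel: "word_value ?A f (positive_word l) = word_value ?A f (positive_word r)"
    if "(l, r) \<in> vb_relations n" for l r
    using that
    by (cases rule: vb_relations.cases; intro eqI)
      (auto simp: fv fh F.m_assoc F.inv_mult_group)
  have "\<exists>h \<in> hom (presented_group (vb_letters n) (vb_rels n)) ?A.
      \<forall>a\<in>vb_letters n. h (generator (vb_letters n) (vb_rels n) a) = f a"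
    by (rule presented_group_hom_exists)
      (use rel fc A.is_group in \<open>auto simp: AutoGroup_Fxq(2)\<close>)
  then obtain h where h: "h \<in> hom (VB n) ?A"
    "\<And>a. a \<in> vb_letters n \<Longrightarrow> h (generator (vb_letters n) (vb_rels n) a) = f a"
    by (auto simp: VB_def)
  have hv: "h (vb_sigma n i) = f (Sig i)" "h (vb_tau n i) = f (Tau i)" if "i \<in> {1..<n}" for i
    using that h(2) by (simp_all add: vb_sigma_def vb_tau_def)
  show ?thesis
    unfolding x_def[symmetric] q_def[symmetric]
    by (intro bexI[OF _ h(1)]) (auto simp: hv fv)
qed

end

theory Submission
  imports Defs
begin

text \<open>
  The automorphism \<open>\<psi>(\<tau>\<^sub>3\<sigma>\<^sub>2\<tau>\<^sub>1\<sigma>\<^sub>2\<^sup>-\<^sup>1)\<close> fixes \<open>q\<close> and \<open>x\<^sub>2\<close>, and with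
  \<open>c = q x\<^sub>2 q\<close> it permutes the other generators cyclically up to conjugation:
  \<open>x\<^sub>1 \<mapsto> c x\<^sub>4 c\<^sup>-\<^sup>1\<close>, \<open>x\<^sub>4 \<mapsto> q\<^sup>-\<^sup>1 x\<^sub>3 q\<close>, \<open>x\<^sub>3 \<mapsto> x\<^sub>2\<^sup>-\<^sup>1 q\<^sup>-\<^sup>1 x\<^sub>1 q x\<^sub>2\<close>.
  All conjugators are fixed, and along the cycle their product is
  \<open>c \<cdot> q\<^sup>-\<^sup>1 \<cdot> x\<^sub>2\<^sup>-\<^sup>1 q\<^sup>-\<^sup>1 = 1\<close>, so the cube is the identity.
\<close>

theorem proposition5p3:
  fixes psi :: "vb_letter word set \<Rightarrow> (xq_letter word set \<Rightarrow> xq_letter word set)"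
  assumes "psi \<in> hom (VB 4) (AutoGroup (Fxq 4))"
    and "\<And>i. i \<in> {1..3} \<Longrightarrow> psi (vb_sigma 4 i) (qgen 4) = qgen 4"
    and "\<And>i. i \<in> {1..3} \<Longrightarrow> psi (vb_tau 4 i) (qgen 4) = qgen 4"
    and "\<And>i j. i \<in> {1..3} \<Longrightarrow> j \<in> {1..4} \<Longrightarrow> psi (vb_sigma 4 i) (xgen 4 j) =
      (if j = i then xgen 4 i \<otimes>\<^bsub>Fxq 4\<^esub> xgen 4 (i+1) \<otimes>\<^bsub>Fxq 4\<^esub> inv\<^bsub>Fxq 4\<^esub> xgen 4 i
       else if j = i + 1 then xgen 4 i
       else xgen 4 j)"
    and "\<And>i j. i \<in> {1..3} \<Longrightarrow> j \<in> {1..4} \<Longrightarrow> psi (vb_tau 4 i) (xgen 4 j) =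
      (if j = i then qgen 4 \<otimes>\<^bsub>Fxq 4\<^esub> xgen 4 (i+1) \<otimes>\<^bsub>Fxq 4\<^esub> inv\<^bsub>Fxq 4\<^esub> qgen 4
       else if j = i + 1 then inv\<^bsub>Fxq 4\<^esub> qgen 4 \<otimes>\<^bsub>Fxq 4\<^esub> xgen 4 i \<otimes>\<^bsub>Fxq 4\<^esub> qgen 4
       else xgen 4 j)"
  shows "(vb_tau 4 3 \<otimes>\<^bsub>VB 4\<^esub> vb_sigma 4 2 \<otimes>\<^bsub>VB 4\<^esub> vb_tau 4 1 \<otimes>\<^bsub>VB 4\<^esub> inv\<^bsub>VB 4\<^esub> vb_sigma 4 2) [^]\<^bsub>VB 4\<^esub> (3::nat)
    \<in> kernel (VB 4) (AutoGroup (Fxq 4)) psi"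
proof -
  let ?F = "Fxq 4" and ?A = "AutoGroup (Fxq 4)"
  interpret F: group ?F by (rule group_Fxq)
  interpret A: group ?A by (rule AutoGroup_Fxq(1))
  interpret VB: group "VB 4" by (simp add: VB_def group_presented_group)
  interpret psi: group_hom "VB 4" ?A psi by unfold_locales (rule assms(1))
  define x where "x = xgen 4"
  define q where "q = qgen 4"
  define s where "s = psi (vb_sigma 4 2)"
  define t1 where "t1 = psi (vb_tau 4 1)"
  define t3 where "t3 = psi (vb_tau 4 3)"
  define u where "u = inv\<^bsub>?A\<^esub> s"
  have xc [simp]: "x 1 \<in> carrier ?F" "x 2 \<in> carrier ?F" "x 3 \<in> carrier ?F" "x 4 \<in> carrier ?F"
    by (simp_all add: x_def xgen_closed)
  have qc [simp]: "q \<in> carrier ?F" by (simp add: q_def qgen_closed)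
  have gens: "vb_sigma 4 2 \<in> carrier (VB 4)" "vb_tau 4 1 \<in> carrier (VB 4)" "vb_tau 4 3 \<in> carrier (VB 4)"
    by (auto simp: vb_sigma_def vb_tau_def VB_def vb_letters_def intro!: generator_closed)
  have autos: "s \<in> auto ?F" "t1 \<in> auto ?F" "t3 \<in> auto ?F" "u \<in> auto ?F"
    using gens psi.hom_closed A.inv_closed
    by (simp_all add: s_def t1_def t3_def u_def flip: AutoGroup_Fxq(2))
  \<comment> \<open>Together with \<open>F.m_assoc\<close> and \<open>F.inv_mult_group\<close> these
    two rules bring products to right-nested form and cancel adjacent inverses there. The word
    identities below are thus settled by free reduction.\<close>
  have canc [simp]: "a \<otimes>\<^bsub>?F\<^esub> (inv\<^bsub>?F\<^esub> a \<otimes>\<^bsub>?F\<^esub> b) = b" "inv\<^bsub>?F\<^esub> a \<otimes>\<^bsub>?F\<^esub> (a \<otimes>\<^bsub>?F\<^esub> b) = b"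
    if "a \<in> carrier ?F" "b \<in> carrier ?F" for a b
    using that by (simp_all add: F.m_assoc[symmetric])
  have aut: "f (inv\<^bsub>?F\<^esub> a) = inv\<^bsub>?F\<^esub> f a" "f a \<in> carrier ?F"
    "b \<in> carrier ?F \<Longrightarrow> f (a \<otimes>\<^bsub>?F\<^esub> b) = f a \<otimes>\<^bsub>?F\<^esub> f b"
    if "f \<in> auto ?F" "a \<in> carrier ?F" for f a b
  proof -
    interpret f: group_hom ?F ?F f
      using that(1) by unfold_locales (simp add: auto_def)
    show "f (inv\<^bsub>?F\<^esub> a) = inv\<^bsub>?F\<^esub> f a" "f a \<in> carrier ?F"
      "b \<in> carrier ?F \<Longrightarrow> f (a \<otimes>\<^bsub>?F\<^esub> b) = f a \<otimes>\<^bsub>?F\<^esub> f b"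
      using that by simp_all
  qed
  note [simp] = aut[OF autos(1)] aut[OF autos(2)] aut[OF autos(3)] aut[OF autos(4)]
  have s: "s q = q" "s (x 1) = x 1" "s (x 2) = x 2 \<otimes>\<^bsub>?F\<^esub> x 3 \<otimes>\<^bsub>?F\<^esub> inv\<^bsub>?F\<^esub> x 2"
      "s (x 3) = x 2" "s (x 4) = x 4"
    using assms(2)[of 2] assms(4)[of 2 1] assms(4)[of 2 2] assms(4)[of 2 3] assms(4)[of 2 4]
    by (simp_all add: s_def x_def q_def)
  have t1: "t1 q = q" "t1 (x 1) = q \<otimes>\<^bsub>?F\<^esub> x 2 \<otimes>\<^bsub>?F\<^esub> inv\<^bsub>?F\<^esub> q"
      "t1 (x 2) = inv\<^bsub>?F\<^esub> q \<otimes>\<^bsub>?F\<^esub> x 1 \<otimes>\<^bsub>?F\<^esub> q" "t1 (x 3) = x 3" "t1 (x 4) = x 4"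
    using assms(3)[of 1] assms(5)[of 1 1] assms(5)[of 1 2] assms(5)[of 1 3] assms(5)[of 1 4]
    by (simp_all add: t1_def x_def q_def numeral_2_eq_2)
  have t3: "t3 q = q" "t3 (x 1) = x 1" "t3 (x 2) = x 2"
      "t3 (x 3) = q \<otimes>\<^bsub>?F\<^esub> x 4 \<otimes>\<^bsub>?F\<^esub> inv\<^bsub>?F\<^esub> q" "t3 (x 4) = inv\<^bsub>?F\<^esub> q \<otimes>\<^bsub>?F\<^esub> x 3 \<otimes>\<^bsub>?F\<^esub> q"
    using assms(3)[of 3] assms(5)[of 3 1] assms(5)[of 3 2] assms(5)[of 3 3] assms(5)[of 3 4]
    by (simp_all add: t3_def x_def q_def)
  \<comment> \<open>The values of \<open>u\<close> are not among the assumptions. As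
    \<open>u\<close> is the inverse of \<open>s\<close>, each is found by exhibiting a preimage
    under \<open>s\<close>.\<close>
  have us: "u b = a" if "s a = b" "a \<in> carrier ?F" for a b
  proof -
    have "u (s a) = (u \<otimes>\<^bsub>?A\<^esub> s) a"
      using autos that by (simp add: AutoGroup_Fxq(4))
    also have "\<dots> = a"
      using autos that by (simp add: u_def AutoGroup_Fxq(2,3))
    finally show ?thesis using that by simp
  qed
  \<comment> \<open>The only value that is not immediate is at \<open>x 3\<close>: \<open>s\<close>
    sends \<open>x 3\<close> to \<open>x 2\<close> and \<open>x 2\<close> to a conjugate by
    \<open>x 2\<close>, so conjugating back gives the preimage.\<close>
  have u: "u q = q" "u (x 1) = x 1" "u (x 2) = x 3"
      "u (x 3) = inv\<^bsub>?F\<^esub> x 3 \<otimes>\<^bsub>?F\<^esub> x 2 \<otimes>\<^bsub>?F\<^esub> x 3" "u (x 4) = x 4"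
    by (rule us; simp add: s F.m_assoc del: One_nat_def)+
  define p where "p = t3 \<otimes>\<^bsub>?A\<^esub> s \<otimes>\<^bsub>?A\<^esub> t1 \<otimes>\<^bsub>?A\<^esub> u"
  have p_auto: "p \<in> auto ?F"
    using autos A.m_closed by (simp add: p_def AutoGroup_Fxq(2))
  note [simp] = aut[OF p_auto]
  \<comment> \<open>The product of automorphisms is composition, so the rightmost factor
    \<open>u\<close> acts first.\<close>
  have p_apply: "p a = t3 (s (t1 (u a)))" if "a \<in> carrier ?F" for a
  proof -
    have "t3 \<otimes>\<^bsub>?A\<^esub> s \<in> auto ?F" "t3 \<otimes>\<^bsub>?A\<^esub> s \<otimes>\<^bsub>?A\<^esub> t1 \<in> auto ?F"
      using autos A.m_closed by (simp_all add: AutoGroup_Fxq(2))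
    then show ?thesis using that autos by (simp add: p_def AutoGroup_Fxq(4))
  qed
  \<comment> \<open>This conjugator arises because \<open>t1\<close> contributes \<open>q\<close>,
    then \<open>s\<close> contributes \<open>x 2\<close>, then \<open>t3\<close> contributes
    \<open>q\<close>.\<close>
  define c where "c = q \<otimes>\<^bsub>?F\<^esub> x 2 \<otimes>\<^bsub>?F\<^esub> q"
  have p: "p q = q" "p (x 2) = x 2"
      "p (x 1) = c \<otimes>\<^bsub>?F\<^esub> x 4 \<otimes>\<^bsub>?F\<^esub> inv\<^bsub>?F\<^esub> c"
      "p (x 4) = inv\<^bsub>?F\<^esub> q \<otimes>\<^bsub>?F\<^esub> x 3 \<otimes>\<^bsub>?F\<^esub> q"
      "p (x 3) = inv\<^bsub>?F\<^esub> x 2 \<otimes>\<^bsub>?F\<^esub> inv\<^bsub>?F\<^esub> q \<otimes>\<^bsub>?F\<^esub> x 1 \<otimes>\<^bsub>?F\<^esub> q \<otimes>\<^bsub>?F\<^esub> x 2"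
    by (simp_all add: p_apply s t1 t3 u c_def F.m_assoc F.inv_mult_group del: One_nat_def)
  \<comment> \<open>Starting the 3-cycle at \<open>x 4\<close> or \<open>x 3\<close> only rotates
    the product of the conjugators cyclically, and a rotation of a trivial product is again
    trivial.\<close>
  have cube: "p (p (p q)) = q" "p (p (p (x 1))) = x 1" "p (p (p (x 2))) = x 2"
      "p (p (p (x 3))) = x 3" "p (p (p (x 4))) = x 4"
    by (simp_all add: p c_def F.m_assoc F.inv_mult_group del: One_nat_def)
  have pp: "p \<otimes>\<^bsub>?A\<^esub> p \<in> auto ?F" "p \<otimes>\<^bsub>?A\<^esub> p \<otimes>\<^bsub>?A\<^esub> p \<in> auto ?F"
    using p_auto A.m_closed by (simp_all add: AutoGroup_Fxq(2))
  have ppp: "(p \<otimes>\<^bsub>?A\<^esub> p \<otimes>\<^bsub>?A\<^esub> p) a = p (p (p a))" if "a \<in> carrier ?F" for a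
    using that p_auto pp by (simp add: AutoGroup_Fxq(4))
  \<comment> \<open>Elements of \<open>auto ?F\<close> are extensional, so agreement on the free
    generators makes them equal as functions; \<open>\<one>\<close> is the identity restricted to
    the carrier.\<close>
  have "p \<otimes>\<^bsub>?A\<^esub> p \<otimes>\<^bsub>?A\<^esub> p = \<one>\<^bsub>?A\<^esub>"
  proof (rule auto_Fxq_eqI[OF pp(2)])
    show "\<one>\<^bsub>?A\<^esub> \<in> auto ?F"
      using A.one_closed by (simp add: AutoGroup_Fxq(2))
    show "(p \<otimes>\<^bsub>?A\<^esub> p \<otimes>\<^bsub>?A\<^esub> p) (qgen 4) = \<one>\<^bsub>?A\<^esub> (qgen 4)"
      using cube by (simp add: ppp AutoGroup_Fxq(3) flip: q_def)
    fix j :: nat assume "j \<in> {1..4}"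
    then have "j = 1 \<or> j = 2 \<or> j = 3 \<or> j = 4" by auto
    then show "(p \<otimes>\<^bsub>?A\<^esub> p \<otimes>\<^bsub>?A\<^esub> p) (xgen 4 j) = \<one>\<^bsub>?A\<^esub> (xgen 4 j)"
      using cube by (auto simp: ppp AutoGroup_Fxq(3) simp flip: x_def simp del: One_nat_def)
  qed
  moreover have "psi (vb_tau 4 3 \<otimes>\<^bsub>VB 4\<^esub> vb_sigma 4 2 \<otimes>\<^bsub>VB 4\<^esub> vb_tau 4 1 \<otimes>\<^bsub>VB 4\<^esub> inv\<^bsub>VB 4\<^esub> vb_sigma 4 2) = p"
    using gens by (simp add: p_def s_def t1_def t3_def u_def)
  moreover have "p \<in> carrier ?A"
    using p_auto by (simp add: AutoGroup_Fxq(2))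
  ultimately show ?thesis
    using gens by (simp add: kernel_def psi.hom_nat_pow numeral_3_eq_3)
qed

end
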